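(* There is an absolute constant $C$ such that: if $G$ is a graph and $f: G \to \mathrm{Cay}(\mathbb{H},\{x,y,z\})$ is a combinatorial embedding, then there is a combinatorial embedding $\tilde f: G \to \mathrm{Cay}(\mathbb{H},\{x,y\})$ with $$\mathrm{diam}(\tilde f) \leq C\cdot \mathrm{diam}(f) \quad\text{and}\quad \mathrm{vol}(\tilde f) \leq C\cdot \mathrm{vol}(f).$$
   Context: Graphs are undirected, without loops or multiple edges; $VG$, $EG$ denote the vertex and edge sets. $\mathbb{H}$ is the discrete Heisenberg group, identified with $\mathbb{Z}^3$ with multiplication $(a,b,c)\cdot(a',b',c') = (a+a',\, b+b',\, c+c'+ab')$, and $x=(1,0,0)$, $y=(0,1,0)$, $z=(0,0,1)$. Cayley graph: $\mathrm{Cay}(\Gamma,S)$ has vertex set $\Gamma$, with an edge between (distinct) $g,h$ if and only if $g^{-1}h \in S\cup S^{-1}$. A walk in a graph $Y$ is a finite sequence of vertices in which consecutive vertices are adjacent. Combinatorial wiring: for graphs $G, Y$, a combinatorial wiring $f: G\to Y$ assigns to each vertex $v \in VG$ a vertex $fv \in VY$ and to each edge $e=\{u,v\}\in EG$ a walk $f_e$ in $Y$ (called a road) with endpoints $fu, fv$. The image of $f$ is the set of all vertices of $Y$ that are in $f(VG)$ or on some road of $f$; the volume $\mathrm{vol}(f)$ and diameter $\mathrm{diam}(f)$ are the cardinality of the image and its diameter in the graph metric of the target graph $Y$ (possibly infinite). Combinatorial embedding: a combinatorial wiring $f: G\to Y$ such that (1) $f|_{VG}$ is injective; (2) for any two non-adjacent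 edges $e,t\in EG$ (no common vertex), $f_e\cap f_t=\emptyset$ (as sets of vertices); (3) for any edge $e \in EG$ and any vertex $v\notin e$, $fv \notin f_e$. *)

theory Defs
  imports "HOL-Algebra.Group" "HOL-Library.Extended_Real"
begin

section \<open>Graphs, walks and the graph metric\<close>

record 'v ugraph =
  verts :: "'v set"
  edges :: "'v set set"

definition simple_graph :: "'v ugraph \<Rightarrow> bool" where
  "simple_graph Y \<longleftrightarrow>
     (\<forall>e \<in> edges Y. \<exists>u v. u \<in> verts Y \<and> v \<in> verts Y \<and> u \<noteq> v \<and> e = {u, v})"

definition walk :: "'v ugraph \<Rightarrow> 'v list \<Rightarrow> bool" where
  "walk Y p \<longleftrightarrow>
     p \<noteq> [] \<and> set p \<subseteq> verts Y \<and> successively (\<lambda>u v. {u, v} \<in> edges Y) p"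

text \<open>The distance is \<open>\<infinity>\<close> (the infimum of the empty set) when no walk joins the two vertices.\<close>

definition graph_dist :: "'v ugraph \<Rightarrow> 'v \<Rightarrow> 'v \<Rightarrow> enat" where
  "graph_dist Y u v =
     (INF p \<in> {p. walk Y p \<and> hd p = u \<and> last p = v}. enat (length p - 1))"

definition diam_in :: "'v ugraph \<Rightarrow> 'v set \<Rightarrow> enat" where
  "diam_in Y A = (SUP u \<in> A. SUP v \<in> A. graph_dist Y u v)"

definition ecard :: "'v set \<Rightarrow> enat" where
  "ecard A = (if finite A then enat (card A) else \<infinity>)"

section \<open>Combinatorial wirings and embeddings\<close>

text \<open>
  Only the values of \<open>vmap\<close> on the vertices and of \<open>road\<close> on the edges of the source graph
  are relevant. An undirected edge has one road, whose direction is left open: its two ends,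
  as an unordered pair, are the images of the two ends of the edge.
\<close>

record ('v, 'w) wiring =
  vmap :: "'v \<Rightarrow> 'w"
  road :: "'v set \<Rightarrow> 'w list"

definition comb_wiring :: "'v ugraph \<Rightarrow> 'w ugraph \<Rightarrow> ('v, 'w) wiring \<Rightarrow> bool" where
  "comb_wiring G Y f \<longleftrightarrow>
     (\<forall>v \<in> verts G. vmap f v \<in> verts Y) \<and>
     (\<forall>e \<in> edges G. walk Y (road f e) \<and>
        {hd (road f e), last (road f e)} = vmap f ` e)"

definition wiring_image :: "'v ugraph \<Rightarrow> ('v, 'w) wiring \<Rightarrow> 'w set" where
  "wiring_image G f = vmap f ` verts G \<union> (\<Union>e \<in> edges G. set (road f e))"

definition vol :: "'v ugraph \<Rightarrow> ('v, 'w) wiring \<Rightarrow> enat" where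
  "vol G f = ecard (wiring_image G f)"

definition diam :: "'v ugraph \<Rightarrow> 'w ugraph \<Rightarrow> ('v, 'w) wiring \<Rightarrow> enat" where
  "diam G Y f = diam_in Y (wiring_image G f)"

definition comb_embedding :: "'v ugraph \<Rightarrow> 'w ugraph \<Rightarrow> ('v, 'w) wiring \<Rightarrow> bool" where
  "comb_embedding G Y f \<longleftrightarrow>
     comb_wiring G Y f \<and>
     inj_on (vmap f) (verts G) \<and>
     (\<forall>e \<in> edges G. \<forall>t \<in> edges G. e \<inter> t = {} \<longrightarrow>
        set (road f e) \<inter> set (road f t) = {}) \<and>
     (\<forall>e \<in> edges G. \<forall>v \<in> verts G. v \<notin> e \<longrightarrow> vmap f v \<notin> set (road f e))"

section \<open>Cayley graphs and the discrete Heisenberg group\<close>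

definition Cay :: "('g, 'm) monoid_scheme \<Rightarrow> 'g set \<Rightarrow> 'g ugraph" where
  "Cay \<Gamma> S = \<lparr> verts = carrier \<Gamma>,
     edges = {{g, h} | g h. g \<in> carrier \<Gamma> \<and> h \<in> carrier \<Gamma> \<and> g \<noteq> h \<and>
                inv\<^bsub>\<Gamma>\<^esub> g \<otimes>\<^bsub>\<Gamma>\<^esub> h \<in> S \<union> m_inv \<Gamma> ` S} \<rparr>"

type_synonym heis = "int \<times> int \<times> int"

fun heis_mult :: "heis \<Rightarrow> heis \<Rightarrow> heis" where
  "heis_mult (a, b, c) (a', b', c') = (a + a', b + b', c + c' + a * b')"

definition Heis :: "heis monoid" where
  "Heis = \<lparr> carrier = UNIV, mult = heis_mult, one = (0, 0, 0) \<rparr>"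

definition hx :: heis where "hx = (1, 0, 0)"
definition hy :: heis where "hy = (0, 1, 0)"
definition hz :: heis where "hz = (0, 0, 1)"

lemma group_Heis: "group Heis"
proof (rule groupI)
  fix g assume "g \<in> carrier Heis"
  obtain a b c where g: "g = (a, b, c)" by (cases g) auto
  show "\<exists>h \<in> carrier Heis. h \<otimes>\<^bsub>Heis\<^esub> g = \<one>\<^bsub>Heis\<^esub>"
    by (rule bexI[of _ "(- a, - b, a * b - c)"]) (simp_all add: Heis_def g)
qed (auto simp: Heis_def algebra_simps)

section \<open>Admissible constants\<close>

text \<open>
  \<open>transfer_constant TYPE('v) C\<close>: the constant \<open>C\<close> works for all graphs, finite or infinite,
  whose vertices are elements of the type \<open>'v\<close>. An absolute constant must be chosen before
  the vertex type, but a HOL formula cannot quantify over types, and in a statement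
  \<open>\<exists>C. transfer_constant TYPE('v) C\<close> the constant could depend on \<open>'v\<close>. Independence of the
  type is expressed by choosing \<open>C\<close> for graphs on \<open>nat\<close> and asserting that
  every such \<open>C\<close> works for graphs on an arbitrary type.
\<close>

definition transfer_constant :: "'v itself \<Rightarrow> real \<Rightarrow> bool" where
  "transfer_constant (_ :: 'v itself) C \<longleftrightarrow>
     (\<forall>(G :: 'v ugraph) f.
        simple_graph G \<and> comb_embedding G (Cay Heis {hx, hy, hz}) f \<longrightarrow>
        (\<exists>f'. comb_embedding G (Cay Heis {hx, hy}) f' \<and>
           ereal_of_enat (diam G (Cay Heis {hx, hy}) f')
             \<le> ereal C * ereal_of_enat (diam G (Cay Heis {hx, hy, hz}) f) \<and>
           ereal_of_enat (vol G f') \<le> ereal C * ereal_of_enat (vol G f)))"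

end

theory Submission
  imports Defs "HOL-Library.Countable"
begin

text \<open>
  It suffices to embed \<open>Cay(H, {x, y, z})\<close> itself, with roads of bounded length, into
  \<open>Cay(H, {x, y})\<close> and to compose. Vertices go by the dilation
  \<open>(a, b, c) \<mapsto> (3a, 3b, 9c)\<close>, an injective endomorphism; \<open>x\<close>- and \<open>y\<close>-edges go to straight
  roads \<open>x\<^sup>3\<close> and \<open>y\<^sup>3\<close>, and \<open>z\<close>-edges to \<open>x y [x, y]\<^sup>9 y\<^sup>-\<^sup>1 x\<^sup>-\<^sup>1\<close>. The factor 3 leaves
  room for the commutators over the interior of a cell of the \<open>x, y\<close>-plane, so roads of
  disjoint edges do not meet.
\<close>

section \<open>Walks of bounded length\<close>

text \<open>The bound \<open>n\<close> counts edges, hence \<open>Suc n\<close> vertices. The region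
  \<open>A\<close> is carried along because disjointness, volume and diameter of the new wiring are
  all read off from where its roads run.\<close>

definition joined :: "'v ugraph \<Rightarrow> 'v set \<Rightarrow> nat \<Rightarrow> 'v \<Rightarrow> 'v \<Rightarrow> bool" where
  "joined Y A n u v \<longleftrightarrow>
     (\<exists>p. walk Y p \<and> hd p = u \<and> last p = v \<and> set p \<subseteq> A \<and> length p \<le> Suc n)"

lemma joined_refl: "u \<in> verts Y \<Longrightarrow> u \<in> A \<Longrightarrow> joined Y A n u u"
  unfolding joined_def by (rule exI[of _ "[u]"]) (auto simp: walk_def)

lemma joined_edge:
  assumes "{u, v} \<in> edges Y" "u \<in> verts Y" "v \<in> verts Y" "u \<in> A" "v \<in> A"
  shows "joined Y A (Suc 0) u v"
  unfolding joined_def using assms by (intro exI[of _ "[u, v]"]) (auto simp: walk_def)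

lemma joined_mono: "joined Y A n u v \<Longrightarrow> A \<subseteq> B \<Longrightarrow> n \<le> m \<Longrightarrow> joined Y B m u v"
  unfolding joined_def by (elim exE conjE) (rule exI, intro conjI, assumption+, auto)

lemma joined_sym:
  assumes "joined Y A n u v"
  shows "joined Y A n v u"
proof -
  obtain p where p: "walk Y p" "hd p = u" "last p = v" "set p \<subseteq> A" "length p \<le> Suc n"
    using assms unfolding joined_def by blast
  have "walk Y (rev p)"
    using p(1) by (simp add: walk_def insert_commute)
  moreover have "hd (rev p) = v" "last (rev p) = u"
    using p by (auto simp: hd_rev last_rev walk_def)
  ultimately show ?thesis
    unfolding joined_def using p by (intro exI[of _ "rev p"]) auto
qed

lemma joined_trans:
  assumes "joined Y A m u v" "joined Y A n v w"
  shows "joined Y A (m + n) u w"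
proof -
  obtain p where p: "walk Y p" "hd p = u" "last p = v" "set p \<subseteq> A" "length p \<le> Suc m"
    using assms unfolding joined_def by blast
  obtain q where q: "walk Y q" "hd q = v" "last q = w" "set q \<subseteq> A" "length q \<le> Suc n"
    using assms unfolding joined_def by blast
  show ?thesis
  proof (cases "tl q")
    case Nil
    then have "v = w" using q by (cases q) (auto simp: walk_def)
    then show ?thesis using p unfolding joined_def by (intro exI[of _ p]) auto
  next
    case (Cons a r)
    then have q': "q = v # a # r" using q by (cases q) (auto simp: walk_def)
    have "walk Y (p @ a # r)"
      using p(1,3) q(1,2) unfolding q' walk_def by (auto simp: successively_append_iff)
    then show ?thesis
      unfolding joined_def using p q(3-5)
      by (intro exI[of _ "p @ a # r"]) (auto simp: q' walk_def)
  qed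
qed

lemma graph_dist_le_iff: "graph_dist Y u v \<le> enat n \<longleftrightarrow> joined Y UNIV n u v"
proof
  assume "graph_dist Y u v \<le> enat n"
  \<comment> \<open>A strict bound on the infimum yields a walk that witnesses it.\<close>
  then have "graph_dist Y u v < enat (Suc n)"
    by (rule le_less_trans) simp
  then obtain p where "walk Y p" "hd p = u" "last p = v" "length p - 1 < Suc n"
    unfolding graph_dist_def by (auto simp: INF_less_iff)
  then show "joined Y UNIV n u v"
    unfolding joined_def by (intro exI[of _ p]) auto
next
  assume "joined Y UNIV n u v"
  then obtain p where p: "walk Y p" "hd p = u" "last p = v" "length p \<le> Suc n"
    unfolding joined_def by blast
  then have "graph_dist Y u v \<le> enat (length p - 1)"
    unfolding graph_dist_def by (intro INF_lower) auto
  also have "\<dots> \<le> enat n" using p(4) by simp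
  finally show "graph_dist Y u v \<le> enat n" .
qed

text \<open>Each vertex of the walk ends an initial segment of it, which is no longer. This confines
  roads to a ball around their start, for the diameter bound.\<close>

lemma joined_ball:
  assumes "joined Y A n u v"
  shows "joined Y (A \<inter> {w. joined Y UNIV n u w}) n u v"
proof -
  obtain p where p: "walk Y p" "hd p = u" "last p = v" "set p \<subseteq> A" "length p \<le> Suc n"
    using assms unfolding joined_def by blast
  have "joined Y UNIV n u w" if w: "w \<in> set p" for w
  proof -
    obtain q r where "p = q @ w # r" using split_list[OF w] by blast
    then have p': "p = (q @ [w]) @ r" by simp
    have "walk Y (q @ [w])"
      using p(1) unfolding p' walk_def successively_append_iff by simp
    moreover have "hd (q @ [w]) = u"
      using p(2) unfolding p' by (cases q) simp_all
    ultimately show ?thesis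
      unfolding joined_def using p(5) by (intro exI[of _ "q @ [w]"]) (simp add: p')
  qed
  then show ?thesis
    unfolding joined_def[of Y _ n u v] using p by (intro exI[of _ p]) auto
qed

lemma graph_dist_eq_0D:
  assumes "graph_dist Y u v = 0"
  shows "u = v"
proof -
  obtain p where p: "walk Y p" "hd p = u" "last p = v" "length p \<le> Suc 0"
    using graph_dist_le_iff[of Y u v 0] assms unfolding joined_def by (auto simp: zero_enat_def)
  then show ?thesis by (cases p) (auto simp: walk_def)
qed

section \<open>Edges of the two Cayley graphs\<close>

abbreviation "CayXY \<equiv> Cay Heis {hx, hy}"
abbreviation "CayXYZ \<equiv> Cay Heis {hx, hy, hz}"

lemma verts_Cay_Heis [simp]: "verts (Cay Heis S) = UNIV"
  by (simp add: Cay_def Heis_def)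

text \<open>Solving for \<open>h\<close> or \<open>g\<close> removes the group inverses, and the
  resulting condition is symmetric in the two ends of the edge.\<close>

lemma Cay_Heis_edge_iff:
  "{g, h} \<in> edges (Cay Heis S) \<longleftrightarrow>
     g \<noteq> h \<and> (\<exists>s\<in>S. h = heis_mult g s \<or> g = heis_mult h s)"
proof -
  interpret group Heis by (rule group_Heis)
  have carr [simp]: "u \<in> carrier Heis" for u
    by (simp add: Heis_def)
  have mult: "u \<otimes>\<^bsub>Heis\<^esub> v = heis_mult u v" for u v
    by (simp add: Heis_def)
  have fwd: "inv\<^bsub>Heis\<^esub> u \<otimes>\<^bsub>Heis\<^esub> v = s \<longleftrightarrow> v = heis_mult u s" for u v s
    by (metis carr inv_solve_left mult)
  have bwd: "inv\<^bsub>Heis\<^esub> u \<otimes>\<^bsub>Heis\<^esub> v = inv\<^bsub>Heis\<^esub> s \<longleftrightarrow> u = heis_mult v s" for u v s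
    by (metis carr inv_inv inv_mult_group fwd)
  have quot: "inv\<^bsub>Heis\<^esub> u \<otimes>\<^bsub>Heis\<^esub> v \<in> S \<union> m_inv Heis ` S \<longleftrightarrow>
      (\<exists>s\<in>S. v = heis_mult u s \<or> u = heis_mult v s)" for u v
  proof -
    let ?t = "inv\<^bsub>Heis\<^esub> u \<otimes>\<^bsub>Heis\<^esub> v"
    have "?t \<in> S \<union> m_inv Heis ` S \<longleftrightarrow> (\<exists>s\<in>S. ?t = s \<or> ?t = inv\<^bsub>Heis\<^esub> s)"
      by blast
    also have "\<dots> \<longleftrightarrow> (\<exists>s\<in>S. v = heis_mult u s \<or> u = heis_mult v s)"
      by (intro bex_cong refl) (simp only: fwd[of u v, symmetric] bwd[of u v, symmetric])
    finally show ?thesis .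
  qed
  have "{g, h} \<in> edges (Cay Heis S) \<longleftrightarrow>
      (\<exists>u v. {g, h} = {u, v} \<and> u \<noteq> v \<and> (\<exists>s\<in>S. v = heis_mult u s \<or> u = heis_mult v s))"
    unfolding Cay_def by (simp add: quot del: split_paired_Ex Un_iff)
  also have "\<dots> \<longleftrightarrow> g \<noteq> h \<and> (\<exists>s\<in>S. h = heis_mult g s \<or> g = heis_mult h s)"
    by (auto simp: doubleton_eq_iff simp del: split_paired_Ex)
  finally show ?thesis .
qed

lemma joined_x:
  "(a, b, c) \<in> A \<Longrightarrow> (a + 1, b, c) \<in> A \<Longrightarrow> joined CayXY A (Suc 0) (a, b, c) (a + 1, b, c)"
  by (rule joined_edge) (auto simp: Cay_Heis_edge_iff hx_def hy_def)

text \<open>Right multiplication by \<open>hy\<close> adds the first coordinate to the central one;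
  this is what makes commutators climb.\<close>

lemma joined_y:
  "(a, b, c) \<in> A \<Longrightarrow> (a, b + 1, c + a) \<in> A \<Longrightarrow>
     joined CayXY A (Suc 0) (a, b, c) (a, b + 1, c + a)"
  by (rule joined_edge) (auto simp: Cay_Heis_edge_iff hx_def hy_def)

section \<open>Embedding one Cayley graph in the other\<close>

fun dil :: "heis \<Rightarrow> heis" where
  "dil (a, b, c) = (3 * a, 3 * b, 9 * c)"

text \<open>
  The image of the edge from \<open>g\<close> to \<open>g s\<close> lies in \<open>dil g\<close> times the following set. For
  \<open>s = z\<close> it leaves the lattice of images of \<open>x\<close>- and \<open>y\<close>-edges through \<open>(1, 0, 0)\<close> and
  climbs over the square \<open>{1, 2} \<times> {1, 2}\<close>, which no such image meets.
\<close>

definition local_track :: "heis \<Rightarrow> heis set" where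
  "local_track s =
     (if s = (0, 0, 0) then {(0, 0, 0)}
      else if s = hx then {0..3} \<times> {0} \<times> {0}
      else if s = hy then {0} \<times> {0..3} \<times> {0}
      else if s = hz then {0, 1} \<times> {0} \<times> {0, 9} \<union> {1, 2} \<times> {1, 2} \<times> {1..12}
      else {})"

text \<open>The region reserved for the image of a road with vertex set \<open>A\<close>. It depends
  on \<open>A\<close> alone, so it covers every step with both ends in \<open>A\<close>, taken by
  the road or not; the trivial step \<open>(0, 0, 0)\<close> contributes the dilated
  vertices.\<close>

definition track :: "heis set \<Rightarrow> heis set" where
  "track A = {heis_mult (dil g) l | g s l. g \<in> A \<and> heis_mult g s \<in> A \<and> l \<in> local_track s}"

lemma track_mono: "A \<subseteq> B \<Longrightarrow> track A \<subseteq> track B"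
  unfolding track_def by blast

lemma dil_in_track:
  assumes "g \<in> A"
  shows "dil g \<in> track A"
proof -
  have "dil g = heis_mult (dil g) (0, 0, 0)" "heis_mult g (0, 0, 0) = g"
    by (cases g; simp)+
  moreover have "(0, 0, 0) \<in> local_track (0, 0, 0)"
    by (simp add: local_track_def)
  ultimately show ?thesis
    unfolding track_def using assms by (metis (mono_tags, lifting) mem_Collect_eq)
qed

text \<open>The first two coordinates are compared modulo 3. Offsets lie in \<open>0..3\<close>, so
  in each coordinate they agree, or one is 0 and the other 3, in neighbouring cells.\<close>

lemma local_tracks_meet:
  assumes "heis_mult (dil g) l = heis_mult (dil g') l'"
    and "l \<in> local_track s" "l' \<in> local_track s'"
  shows "{g, heis_mult g s} \<inter> {g', heis_mult g' s'} \<noteq> {}"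
proof -
  obtain a b c where g: "g = (a, b, c)" by (cases g)
  obtain a' b' c' where g': "g' = (a', b', c')" by (cases g')
  obtain i j k where l: "l = (i, j, k)" by (cases l)
  obtain i' j' k' where l': "l' = (i', j', k')" by (cases l')
  have ea: "3 * a + i = 3 * a' + i'" and eb: "3 * b + j = 3 * b' + j'"
    and ec: "9 * c + k + 3 * a * j = 9 * c' + k' + 3 * a' * j'"
    using assms(1) by (auto simp: g g' l l')
  have ij: "i \<in> {0..3}" "j \<in> {0..3}" "i' \<in> {0..3}" "j' \<in> {0..3}"
    using assms(2,3) by (auto simp: l l' local_track_def split: if_splits)
  have A: "i = i' \<and> a = a' \<or> i = 0 \<and> i' = 3 \<and> a = a' + 1 \<or> i = 3 \<and> i' = 0 \<and> a' = a + 1"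
    using ij ea unfolding atLeastAtMost_iff by presburger
  have B: "j = j' \<and> b = b' \<or> j = 0 \<and> j' = 3 \<and> b = b' + 1 \<or> j = 3 \<and> j' = 0 \<and> b' = b + 1"
    using ij eb unfolding atLeastAtMost_iff by presburger
  have s: "s \<in> {(0, 0, 0), hx, hy, hz}" "s' \<in> {(0, 0, 0), hx, hy, hz}"
    using assms(2,3) by (auto simp: local_track_def split: if_splits)
  show ?thesis
    using A B
  proof (elim disjE conjE)
    \<comment> \<open>In a common cell the term \<open>3 * a * j\<close> cancels. Over the interior,
      \<open>k\<close> and \<open>k'\<close> lie in \<open>1..12\<close> and differ by less than 18,
      so \<open>c\<close> and \<open>c'\<close> differ by at most 1 and the two
      \<open>z\<close>-edges share an end. Elsewhere \<open>k\<close> and \<open>k'\<close> are 0 or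
      9.\<close>
    assume e: "i = i'" "a = a'" "j = j'" "b = b'"
    have "9 * c + k = 9 * c' + k'" using ec e by simp
    then show ?thesis using s assms(2,3)
      by (auto simp: local_track_def hx_def hy_def hz_def g g' l l' e)
  \<comment> \<open>Offset 3 occurs only at the far end of an \<open>x\<close>- or
    \<open>y\<close>-road, so the meeting point is the dilation of an end of that edge.\<close>
  qed (use s assms(2,3) ec in \<open>auto simp: local_track_def hx_def hy_def hz_def g g' l l'\<close>)
qed

text \<open>Used in contrapositive form: roads without a common vertex get images without a common
  vertex.\<close>

lemma tracks_meet: "w \<in> track A \<Longrightarrow> w \<in> track B \<Longrightarrow> A \<inter> B \<noteq> {}"
  unfolding track_def using local_tracks_meet
  by (smt (verit) disjoint_iff empty_iff insert_iff mem_Collect_eq)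

lemma inj_dil: "inj dil"
  by (rule injI) (auto elim!: dil.elims)

text \<open>Source of the volume bound: each vertex accounts for at most
  \<open>4 * 4 * 13 = 208\<close> points.\<close>

lemma track_subset_box:
  "track A \<subseteq> (\<Union>g\<in>A. heis_mult (dil g) ` ({0..3} \<times> {0..3} \<times> {0..12}))"
proof
  fix w assume "w \<in> track A"
  then obtain g s l where "g \<in> A" "l \<in> local_track s" "w = heis_mult (dil g) l"
    unfolding track_def by blast
  moreover from this have "l \<in> {0..3} \<times> {0..3} \<times> {0..12}"
    by (auto simp: local_track_def split: if_splits)
  ultimately show "w \<in> (\<Union>g\<in>A. heis_mult (dil g) ` ({0..3} \<times> {0..3} \<times> {0..12}))"
    by blast
qed

section \<open>Short roads for generators, edges and walks\<close>

lemma joined_translate: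
  assumes "joined CayXY A n u v"
  shows "joined CayXY (heis_mult g ` A) n (heis_mult g u) (heis_mult g v)"
proof -
  obtain p where p: "walk CayXY p" "hd p = u" "last p = v" "set p \<subseteq> A" "length p \<le> Suc n"
    using assms unfolding joined_def by blast
  have assoc: "heis_mult g (heis_mult u s) = heis_mult (heis_mult g u) s" for u s
    by (cases g; cases u; cases s) (simp add: algebra_simps)
  have inj: "heis_mult g u = heis_mult g v \<Longrightarrow> u = v" for u v
    by (cases g; cases u; cases v) simp
  \<comment> \<open>Edges are right multiplications, so by associativity left translation preserves
    them.\<close>
  have "{heis_mult g u, heis_mult g v} \<in> edges CayXY" if "{u, v} \<in> edges CayXY" for u v
    using that inj[of u v] unfolding Cay_Heis_edge_iff by (metis assoc)
  then have "walk CayXY (map (heis_mult g) p)"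
    using p(1) by (auto simp: walk_def successively_map elim: successively_mono)
  then show ?thesis
    unfolding joined_def using p
    by (intro exI[of _ "map (heis_mult g) p"]) (auto simp: hd_map last_map walk_def)
qed

text \<open>One round of the unit square takes four steps and gains height 1: the
  \<open>y\<close>-step at first coordinate 2 adds 2, and the reversed one at first coordinate 1
  takes 1 back.\<close>

lemma local_track_climb:
  assumes "n \<le> 9"
  shows "joined CayXY (local_track hz) (4 * n) (1, 1, 1) (1, 1, 1 + int n)"
  using assms
proof (induction n)
  case 0
  have "(1, 1, 1) \<in> local_track hz"
    by (auto simp: local_track_def hx_def hy_def hz_def)
  then show ?case by (simp add: joined_refl)
next
  case (Suc n)
  let ?L = "local_track hz" and ?k = "1 + int n"
  \<comment> \<open>A round starting at height \<open>?k\<close> reaches \<open>?k + 2\<close>,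
    which is at most 11.\<close>
  have mem: "(i, j, k) \<in> ?L" if "i \<in> {1, 2}" "j \<in> {1, 2}" "k \<in> {1..12}" for i j k
    using that by (auto simp: local_track_def hx_def hy_def hz_def)
  have "joined CayXY ?L (Suc 0) (1, 1, ?k) (2, 1, ?k)"
    using joined_x[of 1 1 ?k ?L] Suc.prems mem by simp
  moreover have "joined CayXY ?L (Suc 0) (2, 1, ?k) (2, 2, ?k + 2)"
    using joined_y[of 2 1 ?k ?L] Suc.prems mem by simp
  moreover have "joined CayXY ?L (Suc 0) (2, 2, ?k + 2) (1, 2, ?k + 2)"
    using joined_x[of 1 2 "?k + 2" ?L, THEN joined_sym] Suc.prems mem by simp
  moreover have "joined CayXY ?L (Suc 0) (1, 2, ?k + 2) (1, 1, ?k + 1)"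
    using joined_y[of 1 1 "?k + 1" ?L, THEN joined_sym] Suc.prems mem by (simp add: add.commute)
  moreover have "joined CayXY ?L (4 * n) (1, 1, 1) (1, 1, ?k)"
    using Suc by simp
  ultimately have "joined CayXY ?L (4 * n + (Suc 0 + (Suc 0 + (Suc 0 + Suc 0)))) (1, 1, 1) (1, 1, ?k + 1)"
    by (blast intro: joined_trans)
  moreover have "4 * n + (Suc 0 + (Suc 0 + (Suc 0 + Suc 0))) = 4 * Suc n" "?k + 1 = 1 + int (Suc n)"
    by simp_all
  ultimately show ?case by (simp only:)
qed

text \<open>The bound 40 comes from \<open>hz\<close>: two steps out to \<open>(1, 1, 1)\<close>,
  nine rounds of four steps, two steps back.\<close>

lemma local_track_joined:
  assumes "s \<in> {hx, hy, hz}"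
  shows "joined CayXY (local_track s) 40 (0, 0, 0) (dil s)"
proof -
  consider "s = hx" | "s = hy" | "s = hz" using assms by blast
  then show ?thesis
  proof cases
    case 1
    have L: "(i, 0, 0) \<in> local_track s" if "i \<in> {0..3}" for i
      using that by (auto simp: 1 local_track_def hx_def hy_def hz_def)
    have "joined CayXY (local_track s) (Suc 0) (0, 0, 0) (1, 0, 0)"
      using joined_x[of 0 0 0 "local_track s"] L by simp
    moreover have "joined CayXY (local_track s) (Suc 0) (1, 0, 0) (2, 0, 0)"
      using joined_x[of 1 0 0 "local_track s"] L by simp
    moreover have "joined CayXY (local_track s) (Suc 0) (2, 0, 0) (3, 0, 0)"
      using joined_x[of 2 0 0 "local_track s"] L by simp
    ultimately have "joined CayXY (local_track s) (Suc 0 + (Suc 0 + Suc 0)) (0, 0, 0) (3, 0, 0)"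
      by (blast intro: joined_trans)
    then have "joined CayXY (local_track s) 40 (0, 0, 0) (3, 0, 0)"
      by (rule joined_mono) auto
    then show ?thesis by (simp add: 1 hx_def)
  next
    case 2
    have L: "(0, j, 0) \<in> local_track s" if "j \<in> {0..3}" for j
      using that by (auto simp: 2 local_track_def hx_def hy_def hz_def)
    have "joined CayXY (local_track s) (Suc 0) (0, 0, 0) (0, 1, 0)"
      using joined_y[of 0 0 0 "local_track s"] L by simp
    moreover have "joined CayXY (local_track s) (Suc 0) (0, 1, 0) (0, 2, 0)"
      using joined_y[of 0 1 0 "local_track s"] L by simp
    moreover have "joined CayXY (local_track s) (Suc 0) (0, 2, 0) (0, 3, 0)"
      using joined_y[of 0 2 0 "local_track s"] L by simp
    ultimately have "joined CayXY (local_track s) (Suc 0 + (Suc 0 + Suc 0)) (0, 0, 0) (0, 3, 0)"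
      by (blast intro: joined_trans)
    then have "joined CayXY (local_track s) 40 (0, 0, 0) (0, 3, 0)"
      by (rule joined_mono) auto
    then show ?thesis by (simp add: 2 hy_def)
  next
    case 3
    let ?L = "local_track hz"
    have L: "(0,0,0) \<in> ?L" "(1,0,0) \<in> ?L" "(1,1,1) \<in> ?L" "(1,1,10) \<in> ?L" "(1,0,9) \<in> ?L" "(0,0,9) \<in> ?L"
      by (auto simp: local_track_def hx_def hy_def hz_def)
    have "joined CayXY ?L (Suc 0) (0, 0, 0) (1, 0, 0)"
      using joined_x[of 0 0 0 ?L] L by simp
    moreover have "joined CayXY ?L (Suc 0) (1, 0, 0) (1, 1, 1)"
      using joined_y[of 1 0 0 ?L] L by simp
    moreover have "joined CayXY ?L 36 (1, 1, 1) (1, 1, 10)"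
      using local_track_climb[of 9] by simp
    moreover have "joined CayXY ?L (Suc 0) (1, 1, 10) (1, 0, 9)"
      using joined_y[of 1 0 9 ?L, THEN joined_sym] L by simp
    moreover have "joined CayXY ?L (Suc 0) (1, 0, 9) (0, 0, 9)"
      using joined_x[of 0 0 9 ?L, THEN joined_sym] L by simp
    ultimately have "joined CayXY ?L (Suc 0 + (Suc 0 + (36 + (Suc 0 + Suc 0)))) (0, 0, 0) (0, 0, 9)"
      by (blast intro: joined_trans)
    then show ?thesis by (simp add: 3 hz_def)
  qed
qed

text \<open>Since \<open>dil\<close> is a homomorphism, the road from the identity to
  \<open>dil s\<close> only has to be translated by \<open>dil g\<close>.\<close>

lemma dil_joined_step:
  assumes "s \<in> {hx, hy, hz}"
  shows "joined CayXY (track {g, heis_mult g s}) 40 (dil g) (dil (heis_mult g s))"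
proof -
  have "joined CayXY (heis_mult (dil g) ` local_track s) 40
      (heis_mult (dil g) (0, 0, 0)) (heis_mult (dil g) (dil s))"
    using assms by (intro joined_translate local_track_joined)
  moreover have "heis_mult (dil g) (0, 0, 0) = dil g"
    by (cases g) simp
  moreover have "heis_mult (dil g) (dil s) = dil (heis_mult g s)"
    by (cases g; cases s) simp
  moreover have "heis_mult (dil g) ` local_track s \<subseteq> track {g, heis_mult g s}"
    unfolding track_def by blast
  ultimately show ?thesis
    by (metis joined_mono order_refl)
qed

lemma dil_joined_edge:
  assumes "{g, h} \<in> edges CayXYZ"
  shows "joined CayXY (track {g, h} \<inter> {w. joined CayXY UNIV 40 (dil g) w}) 40 (dil g) (dil h)"
proof -
  obtain s where s: "s \<in> {hx, hy, hz}" "h = heis_mult g s \<or> g = heis_mult h s"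
    using assms unfolding Cay_Heis_edge_iff by blast
  from s(2) have "joined CayXY (track {g, h}) 40 (dil g) (dil h)"
  proof
    assume "h = heis_mult g s"
    then show ?thesis using dil_joined_step[OF s(1), of g] by simp
  next
    assume "g = heis_mult h s"
    then show ?thesis
      using dil_joined_step[OF s(1), of h, THEN joined_sym] by (simp add: insert_commute)
  qed
  then show ?thesis by (rule joined_ball)
qed

text \<open>Complements \<open>track\<close>: that region controls disjointness and volume, this one
  the diameter.\<close>

definition near :: "heis set \<Rightarrow> heis set" where
  "near A = {w. \<exists>g\<in>A. joined CayXY UNIV 40 (dil g) w}"

lemma dil_in_near: "g \<in> A \<Longrightarrow> dil g \<in> near A"
  unfolding near_def using joined_refl[of "dil g" CayXY UNIV 40] by auto

lemma dil_joined_walk: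
  assumes "walk CayXYZ p"
  shows "joined CayXY (track (set p) \<inter> near (set p)) (40 * (length p - 1)) (dil (hd p)) (dil (last p))"
  using assms
proof (induction p rule: induct_list012)
  case 1
  then show ?case by (simp add: walk_def)
next
  case (2 g)
  show ?case by (auto intro!: joined_refl dil_in_track dil_in_near)
next
  case (3 g h p)
  let ?B = "track (set (g # h # p)) \<inter> near (set (g # h # p))"
  have e: "{g, h} \<in> edges CayXYZ" and w: "walk CayXYZ (h # p)"
    using "3.prems" by (auto simp: walk_def)
  have "joined CayXY ?B 40 (dil g) (dil h)"
    using track_mono[of "{g, h}" "set (g # h # p)"]
    by (intro joined_mono[OF dil_joined_edge[OF e]]) (auto simp: near_def)
  moreover have "joined CayXY ?B (40 * (length (h # p) - 1)) (dil h) (dil (last (h # p)))"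
    using track_mono[of "set (h # p)" "set (g # h # p)"]
    by (intro joined_mono[OF "3.IH"(2)[OF w, unfolded list.sel]]) (auto simp: near_def)
  ultimately have "joined CayXY ?B (40 + 40 * (length (h # p) - 1)) (dil g) (dil (last (h # p)))"
    by (rule joined_trans)
  then show ?case by simp
qed

section \<open>Transfer of embeddings\<close>

text \<open>A vertex is treated as a one-point road; this keeps roads away from the images of
  vertices off their edge.\<close>

lemma dil_track_meet:
  assumes "dil g \<in> track A"
  shows "g \<in> A"
  using tracks_meet[OF assms dil_in_track[of g "{g}"]] by simp

section \<open>Bounds on diameter and volume\<close>

lemma diam_near_le:
  assumes "A' \<subseteq> near A" and "diam_in CayXYZ A \<noteq> 0"
  shows "diam_in CayXY A' \<le> 120 * diam_in CayXYZ A"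
proof (cases "diam_in CayXYZ A")
  case (enat n)
  have n: "n \<noteq> 0" using assms(2) enat by (auto simp: zero_enat_def)
  have "graph_dist CayXY u v \<le> enat (120 * n)" if "u \<in> A'" "v \<in> A'" for u v
  proof -
    obtain g h where gh: "g \<in> A" "h \<in> A" "joined CayXY UNIV 40 (dil g) u" "joined CayXY UNIV 40 (dil h) v"
      using \<open>u \<in> A'\<close> \<open>v \<in> A'\<close> assms(1) unfolding near_def by blast
    have "graph_dist CayXYZ g h \<le> diam_in CayXYZ A"
      unfolding diam_in_def using gh by (meson SUP_upper2 order_refl)
    then have "joined CayXYZ UNIV n g h" by (simp add: enat graph_dist_le_iff)
    then obtain p where p: "walk CayXYZ p" "hd p = g" "last p = h" "length p \<le> Suc n"
      unfolding joined_def by blast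
    have "joined CayXY UNIV (40 * n) (dil g) (dil h)"
      using p by (intro joined_mono[OF dil_joined_walk[OF p(1), unfolded p(2,3)]]) auto
    \<comment> \<open>From \<open>u\<close> to \<open>dil g\<close>, on to \<open>dil h\<close>,
      then to \<open>v\<close>: at most \<open>40 * n + 80\<close> steps, hence at most
      \<open>120 * n\<close> because \<open>n\<close> is nonzero.\<close>
    with gh have "joined CayXY UNIV (40 + (40 * n + 40)) u v"
      by (meson joined_sym joined_trans)
    then show ?thesis
      unfolding graph_dist_le_iff using n by (elim joined_mono) auto
  qed
  then have "diam_in CayXY A' \<le> enat (120 * n)"
    unfolding diam_in_def by (intro SUP_least)
  then show ?thesis by (simp add: enat numeral_eq_enat)
qed (simp add: numeral_eq_enat)

lemma vol_track_le:
  assumes "A' \<subseteq> track A"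
  shows "ecard A' \<le> 208 * ecard A"
proof (cases "finite A")
  case True
  let ?box = "{0..3} \<times> {0..3} \<times> {0..12} :: heis set"
  let ?U = "\<Union>g\<in>A. heis_mult (dil g) ` ?box"
  have "card ?U \<le> (\<Sum>g\<in>A. card (heis_mult (dil g) ` ?box))"
    by (rule card_UN_le[OF True])
  also have "\<dots> \<le> (\<Sum>g\<in>A. 208)"
    by (rule sum_mono, rule order_trans[OF card_image_le]) (auto simp: card_cartesian_product)
  finally have card: "card ?U \<le> 208 * card A" by simp
  have sub: "A' \<subseteq> ?U" using assms track_subset_box by blast
  have fin: "finite ?U"
    using True by (intro finite_UN_I finite_imageI finite_cartesian_product) simp_all
  have "finite A'" using sub fin by (rule finite_subset)
  moreover have "card A' \<le> 208 * card A"
    using card_mono[OF fin sub] card by (rule le_trans)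
  ultimately show ?thesis using True by (simp add: ecard_def numeral_eq_enat)
qed (simp add: ecard_def numeral_eq_enat)

lemma simple_graphE:
  assumes "simple_graph G" "e \<in> edges G"
  obtains u v where "u \<in> verts G" "v \<in> verts G" "u \<noteq> v" "e = {u, v}"
  using assms unfolding simple_graph_def by blast

text \<open>The two ends of an edge have distinct images, hence positive distance.\<close>

lemma diam_ne_0:
  assumes G: "simple_graph G" and f: "comb_embedding G Y f" and "edges G \<noteq> {}"
  shows "diam_in Y (wiring_image G f) \<noteq> 0"
proof
  assume 0: "diam_in Y (wiring_image G f) = 0"
  obtain e where "e \<in> edges G" using assms by blast
  then obtain u v where uv: "u \<in> verts G" "v \<in> verts G" "u \<noteq> v"
    using G by (elim simple_graphE)
  then have "vmap f u \<noteq> vmap f v" "vmap f u \<in> wiring_image G f" "vmap f v \<in> wiring_image G f"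
    using f by (auto simp: comb_embedding_def wiring_image_def inj_on_def)
  moreover from this have "graph_dist Y (vmap f u) (vmap f v) \<le> diam_in Y (wiring_image G f)"
    unfolding diam_in_def by (meson SUP_upper2 order_refl)
  ultimately show False
    using 0 graph_dist_eq_0D[of Y "vmap f u" "vmap f v"] by simp
qed

text \<open>Distance 0 forces equality, so \<open>A\<close> has at most one point. This is the case
  where the additive error 80 could not be absorbed.\<close>

lemma diam_dil_eq_0:
  assumes "diam_in CayXYZ A = 0"
  shows "diam_in CayXY (dil ` A) = 0"
proof -
  have "graph_dist CayXYZ g h \<le> 0" if "g \<in> A" "h \<in> A" for g h
    unfolding assms[symmetric] diam_in_def using that by (meson SUP_upper2 order_refl)
  then have "g = h" if "g \<in> A" "h \<in> A" for g h
    using that graph_dist_eq_0D by (metis le_zero_eq)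
  moreover have "graph_dist CayXY u u \<le> enat 0" for u
    unfolding graph_dist_le_iff by (rule joined_refl) auto
  ultimately have "diam_in CayXY (dil ` A) \<le> enat 0"
    unfolding diam_in_def by (intro SUP_least) (metis imageE)
  then show ?thesis by (simp add: zero_enat_def[symmetric])
qed

section \<open>The composed embedding\<close>

lemma transfer_embedding:
  assumes G: "simple_graph G" and f: "comb_embedding G CayXYZ f"
  shows "\<exists>f'. comb_embedding G CayXY f' \<and>
    diam G CayXY f' \<le> 120 * diam G CayXYZ f \<and> vol G f' \<le> 208 * vol G f"
proof -
  have W: "walk CayXYZ (road f e)" "{hd (road f e), last (road f e)} = vmap f ` e"
    if "e \<in> edges G" for e
    using f that by (auto simp: comb_embedding_def comb_wiring_def)
  \<comment> \<open>Each new road runs in the direction of the old one, so \<open>dil\<close>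
    carries the unordered pair of ends over.\<close>
  have "\<forall>e\<in>edges G. \<exists>p. walk CayXY p \<and> hd p = dil (hd (road f e)) \<and> last p = dil (last (road f e))
      \<and> set p \<subseteq> track (set (road f e)) \<inter> near (set (road f e))"
    using dil_joined_walk[OF W(1)] unfolding joined_def by blast
  then obtain r where r: "\<And>e. e \<in> edges G \<Longrightarrow> walk CayXY (r e)"
      "\<And>e. e \<in> edges G \<Longrightarrow> hd (r e) = dil (hd (road f e))"
      "\<And>e. e \<in> edges G \<Longrightarrow> last (r e) = dil (last (road f e))"
      "\<And>e. e \<in> edges G \<Longrightarrow> set (r e) \<subseteq> track (set (road f e)) \<inter> near (set (road f e))"
    by metis
  define f' where "f' = \<lparr>vmap = dil \<circ> vmap f, road = r\<rparr>"
  have f'_simps [simp]: "vmap f' v = dil (vmap f v)" "road f' = r" for v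
    by (simp_all add: f'_def)
  let ?A = "wiring_image G f" and ?A' = "wiring_image G f'"
  have "{hd (r e), last (r e)} = vmap f' ` e" if "e \<in> edges G" for e
  proof -
    have "{hd (r e), last (r e)} = dil ` {hd (road f e), last (road f e)}"
      using r that by simp
    also have "\<dots> = vmap f' ` e" using W(2)[OF that] by auto
    finally show ?thesis .
  qed
  then have "comb_wiring G CayXY f'"
    unfolding comb_wiring_def using r(1) by simp
  moreover have "inj_on (vmap f') (verts G)"
    using f inj_dil unfolding comb_embedding_def inj_on_def by (metis UNIV_I f'_simps(1))
  moreover have "set (r e) \<inter> set (r t) = {}" if "e \<in> edges G" "t \<in> edges G" "e \<inter> t = {}" for e t
  proof -
    have "set (road f e) \<inter> set (road f t) = {}"
      using f that unfolding comb_embedding_def by blast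
    then show ?thesis using r(4)[OF that(1)] r(4)[OF that(2)] tracks_meet by blast
  qed
  moreover have "vmap f' v \<notin> set (r e)" if "e \<in> edges G" "v \<in> verts G" "v \<notin> e" for e v
  proof -
    have "vmap f v \<notin> set (road f e)"
      using f that unfolding comb_embedding_def by blast
    then have "dil (vmap f v) \<notin> track (set (road f e))"
      using dil_track_meet by blast
    then show ?thesis using r(4)[OF that(1)] by auto
  qed
  ultimately have "comb_embedding G CayXY f'"
    unfolding comb_embedding_def by simp
  moreover have "?A' \<subseteq> track ?A \<inter> near ?A"
  proof
    fix w assume "w \<in> ?A'"
    then consider v where "v \<in> verts G" "w = vmap f' v" | e where "e \<in> edges G" "w \<in> set (r e)"
      unfolding wiring_image_def by auto
    then show "w \<in> track ?A \<inter> near ?A"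
    proof cases
      case 1
      then have "vmap f v \<in> ?A" by (simp add: wiring_image_def)
      then show ?thesis
        using 1 by (simp only: f'_simps Int_iff dil_in_track dil_in_near)
    next
      case 2
      then have "set (road f e) \<subseteq> ?A" by (auto simp: wiring_image_def)
      then have "track (set (road f e)) \<inter> near (set (road f e)) \<subseteq> track ?A \<inter> near ?A"
        using track_mono by (auto simp: near_def)
      then show ?thesis using r(4) 2 by blast
    qed
  qed
  moreover have "diam_in CayXY ?A' \<le> 120 * diam_in CayXYZ ?A"
  \<comment> \<open>At diameter 0 there are no edges, so the new image is exactly the dilated old
    one.\<close>
  proof (cases "diam_in CayXYZ ?A = 0")
    case True
    then have "edges G = {}" using diam_ne_0[OF G f] by blast
    then have "?A' = dil ` ?A" by (auto simp: wiring_image_def)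
    then show ?thesis using diam_dil_eq_0[OF True] by simp
  next
    case False
    then show ?thesis using diam_near_le \<open>?A' \<subseteq> track ?A \<inter> near ?A\<close> by blast
  qed
  ultimately show ?thesis
    unfolding diam_def vol_def using vol_track_le by blast
qed

section \<open>Change of the vertex type\<close>

definition pull :: "('v \<Rightarrow> 'u) \<Rightarrow> ('u, 'w) wiring \<Rightarrow> ('v, 'w) wiring" where
  "pull \<phi> f = \<lparr>vmap = vmap f \<circ> \<phi>, road = (\<lambda>e. road f (\<phi> ` e))\<rparr>"

lemma pull_simps [simp]: "vmap (pull \<phi> f) v = vmap f (\<phi> v)" "road (pull \<phi> f) e = road f (\<phi> ` e)"
  by (simp_all add: pull_def)

definition map_graph :: "('v \<Rightarrow> 'u) \<Rightarrow> 'v ugraph \<Rightarrow> 'u ugraph" where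
  "map_graph \<phi> G = \<lparr>verts = \<phi> ` verts G, edges = (`) \<phi> ` edges G\<rparr>"

lemma map_graph_simps [simp]:
  "verts (map_graph \<phi> G) = \<phi> ` verts G" "edges (map_graph \<phi> G) = (`) \<phi> ` edges G"
  by (simp_all add: map_graph_def)

lemma simple_map_graph:
  assumes "simple_graph G" "inj_on \<phi> (verts G)"
  shows "simple_graph (map_graph \<phi> G)"
  unfolding simple_graph_def
proof
  fix e' assume "e' \<in> edges (map_graph \<phi> G)"
  then obtain e where e: "e \<in> edges G" "e' = \<phi> ` e" by auto
  obtain u v where "u \<in> verts G" "v \<in> verts G" "u \<noteq> v" "e = {u, v}"
    using assms(1) e(1) by (rule simple_graphE)
  moreover from this have "\<phi> u \<noteq> \<phi> v"
    using assms(2) by (meson inj_onD)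
  ultimately show "\<exists>u v. u \<in> verts (map_graph \<phi> G) \<and> v \<in> verts (map_graph \<phi> G) \<and> u \<noteq> v \<and> e' = {u, v}"
    using e(2) by (intro exI[of _ "\<phi> u"] exI[of _ "\<phi> v"]) simp
qed

lemma wiring_image_pull: "wiring_image G (pull \<phi> f) = wiring_image (map_graph \<phi> G) f"
  by (auto simp: wiring_image_def)

text \<open>Injectivity of \<open>\<phi>\<close> keeps disjoint edges disjoint and vertices off an
  edge off its image.\<close>

lemma comb_embedding_pull:
  assumes G: "simple_graph G" and inj: "inj_on \<phi> (verts G)"
    and f: "comb_embedding (map_graph \<phi> G) Y f"
  shows "comb_embedding G Y (pull \<phi> f)"
proof -
  have sub: "e \<subseteq> verts G" if "e \<in> edges G" for e
    using G that by (elim simple_graphE) auto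
  have "comb_wiring G Y (pull \<phi> f)"
    using f by (auto simp: comb_embedding_def comb_wiring_def image_image)
  moreover have "inj_on (vmap (pull \<phi> f)) (verts G)"
    using f comp_inj_on[OF inj, of "vmap f"] by (simp add: comb_embedding_def pull_def)
  moreover have "\<phi> ` e \<inter> \<phi> ` t = {}" if "e \<in> edges G" "t \<in> edges G" "e \<inter> t = {}" for e t
    using inj_on_image_Int[OF inj sub[OF that(1)] sub[OF that(2)]] that(3) by simp
  moreover have "\<phi> v \<notin> \<phi> ` e" if "e \<in> edges G" "v \<in> verts G" "v \<notin> e" for e v
    using inj_on_image_mem_iff[OF inj that(2) sub[OF that(1)]] that(3) by simp
  ultimately show ?thesis
    using f unfolding comb_embedding_def by simp
qed

text \<open>\<open>inv_into\<close> inverts \<open>\<phi>\<close> only on \<open>verts G\<close>;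
  simplicity places every edge inside that set.\<close>

lemma map_graph_inv_into:
  assumes "simple_graph G" "inj_on \<phi> (verts G)"
  shows "map_graph (inv_into (verts G) \<phi>) (map_graph \<phi> G) = G"
proof -
  let ?\<psi> = "inv_into (verts G) \<phi>"
  have "?\<psi> ` \<phi> ` e = e" if "e \<subseteq> verts G" for e
    using assms(2) that by (rule inv_into_image_cancel)
  moreover have "e \<subseteq> verts G" if "e \<in> edges G" for e
    using assms(1) that by (elim simple_graphE) auto
  ultimately have "?\<psi> ` \<phi> ` verts G = verts G" "(`) ?\<psi> ` (`) \<phi> ` edges G = edges G"
    by (auto simp: image_image)
  then show ?thesis by (cases G) (simp add: map_graph_def)
qed

text \<open>An embedding is injective on vertices and the Heisenberg group is countable, so every
  graph in question is isomorphic to one on \<open>nat\<close>.\<close>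

lemma transfer_constant_any_type:
  assumes C: "transfer_constant TYPE(nat) C"
  shows "transfer_constant TYPE('v) C"
  unfolding transfer_constant_def
proof (intro allI impI, elim conjE)
  fix G :: "'v ugraph" and f
  assume G: "simple_graph G" and f: "comb_embedding G CayXYZ f"
  define \<phi> where "\<phi> = (to_nat :: heis \<Rightarrow> nat) \<circ> vmap f"
  let ?\<psi> = "inv_into (verts G) \<phi>" and ?H = "map_graph \<phi> G"
  have inj: "inj_on \<phi> (verts G)"
    using f by (auto simp: \<phi>_def comb_embedding_def inj_on_def)
  have H: "simple_graph ?H" using G inj by (rule simple_map_graph)
  have inv: "map_graph ?\<psi> ?H = G" using G inj by (rule map_graph_inv_into)
  \<comment> \<open>Move \<open>f\<close> to the copy on \<open>nat\<close>, where \<open>C\<close>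
    applies; the result is pulled back along \<open>\<phi>\<close>. Images, hence diameters and
    volumes, do not change.\<close>
  have "comb_embedding ?H CayXYZ (pull ?\<psi> f)"
    using H f inj_on_inv_into[of "\<phi> ` verts G" \<phi> "verts G"]
    by (intro comb_embedding_pull) (simp_all only: inv map_graph_simps order_refl)
  moreover have "wiring_image ?H (pull ?\<psi> f) = wiring_image G f"
    by (simp only: wiring_image_pull inv)
  ultimately obtain h where h: "comb_embedding ?H CayXY h"
     "ereal_of_enat (diam ?H CayXY h) \<le> ereal C * ereal_of_enat (diam G CayXYZ f)"
     "ereal_of_enat (vol ?H h) \<le> ereal C * ereal_of_enat (vol G f)"
    using C H unfolding transfer_constant_def diam_def vol_def by metis
  show "\<exists>f'. comb_embedding G CayXY f' \<and>
      ereal_of_enat (diam G CayXY f') \<le> ereal C * ereal_of_enat (diam G CayXYZ f) \<and>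
      ereal_of_enat (vol G f') \<le> ereal C * ereal_of_enat (vol G f)"
    using h comb_embedding_pull[OF G inj h(1)]
    by (intro exI[of _ "pull \<phi> h"]) (simp add: diam_def vol_def wiring_image_pull)
qed

section \<open>The explicit constant\<close>

lemma ereal_of_enat_le_mult:
  assumes "x \<le> numeral k * y"
  shows "ereal_of_enat x \<le> ereal (numeral k) * ereal_of_enat y"
proof -
  have "ereal_of_enat x \<le> ereal_of_enat (numeral k * y)"
    using assms by simp
  then show ?thesis by (simp add: ereal_of_enat_mult numeral_eq_enat)
qed

lemma transfer_constant_208: "transfer_constant TYPE('v) 208"
  unfolding transfer_constant_def
proof (intro allI impI, elim conjE)
  fix G :: "'v ugraph" and f
  assume "simple_graph G" and "comb_embedding G CayXYZ f"
  then obtain f' where f': "comb_embedding G CayXY f'"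
      "diam G CayXY f' \<le> 120 * diam G CayXYZ f" "vol G f' \<le> 208 * vol G f"
    using transfer_embedding by blast
  \<comment> \<open>One constant must serve both bounds, so the larger of 120 and 208 is
    taken.\<close>
  have "diam G CayXY f' \<le> 208 * diam G CayXYZ f"
    using f'(2) by (rule order_trans) (auto intro: mult_right_mono)
  with f' show "\<exists>f'. comb_embedding G CayXY f' \<and>
      ereal_of_enat (diam G CayXY f') \<le> ereal 208 * ereal_of_enat (diam G CayXYZ f) \<and>
      ereal_of_enat (vol G f') \<le> ereal 208 * ereal_of_enat (vol G f)"
    by (blast intro: ereal_of_enat_le_mult)
qed

theorem proposition1p3:
  "(\<exists>C::real. transfer_constant TYPE(nat) C) \<and>
   (\<forall>C::real. transfer_constant TYPE(nat) C \<longrightarrow> transfer_constant TYPE('v) C)"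
  using transfer_constant_208 transfer_constant_any_type by blast

end
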